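(* Let $(X,d)$ be a metric space, let $T:X\to X$ be a self-mapping, and let $r=\inf\{d(Tu,u): Tu\neq u,\ u\in X\}$. If $T$ is a Pata Zamfirescu type $x_0$-mapping with respect to $\Psi\in\Theta$ for $x_0\in X$ and $d(Tu,x_0)\le r$ for each $u\in D[x_0,r]\setminus\{x_0\}$, then $D[x_0,r]$ is a fixed disc of $T$, that is, $Tu=u$ for all $u\in D[x_0,r]$.
   Context: For $x_0\in X$ and $r\ge 0$, the disc is $D[x_0,r]=\{u\in X: d(u,x_0)\le r\}$. It is called a fixed disc of $T$ if $Tu=u$ for all $u\in D[x_0,r]$. $\Theta$ denotes the class of all increasing (i.e. nondecreasing) functions $\Psi:[0,1]\to[0,\infty)$ with $\Psi(0)=0$ (no continuity is required). Let $\Lambda\ge 0$, $\alpha\ge 1$ and $\beta\in[0,\alpha]$ be constants. For $x_0\in X$ and $\Psi\in\Theta$, the self-mapping $T$ is called a Pata Zamfirescu type $x_0$-mapping with respect to $\Psi$ if for all $u\in X$ and each $\varepsilon\in[0,1]$, $$d(Tu,u)>0\Longrightarrow d(Tu,u)\le \frac{1-\varepsilon}{2}M(u,x_0)+\Lambda\varepsilon^{\alpha}\Psi(\varepsilon)\left[1+\|u\|+\|x_0\|+\|Tu\|+\|Tx_0\|\right]^{\beta},$$ where $\|u\|=d(u,x_0)$ and $$M(u,v)=\max\left\{d(u,v),\ \frac{d(Tu,u)+d(Tv,v)}{2},\ \frac{d(Tv,u)+d(Tu,v)}{2}\right\}.$$ *)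

theory Defs
  imports "HOL-Analysis.Analysis"
begin

text \<open>
  The class \<open>\<Theta>\<close>.  A function on the unit interval is rendered as a total function on the reals
  of which only the values on \<open>{0..1}\<close> are constrained (and, below, used).
\<close>

definition Theta_class :: "(real \<Rightarrow> real) set" where
  "Theta_class = {\<Psi>. mono_on {0..1} \<Psi> \<and> (\<forall>t\<in>{0..1}. 0 \<le> \<Psi> t) \<and> \<Psi> 0 = 0}"

definition zamf_max :: "('a::metric_space \<Rightarrow> 'a) \<Rightarrow> 'a \<Rightarrow> 'a \<Rightarrow> real" where
  "zamf_max T u v =
     Max {dist u v, (dist (T u) u + dist (T v) v) / 2, (dist (T v) u + dist (T u) v) / 2}"

text \<open>
  In the bracket below, \<open>\<parallel>u\<parallel>\<close> is the distance of \<open>u\<close> to the base point \<open>x0\<close>.  The exponents are real,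
  hence \<open>powr\<close>; \<open>0 powr \<alpha> = 0\<close> is the intended value, as \<open>\<alpha> \<ge> 1\<close>.
\<close>

definition pata_zamfirescu_mapping ::
  "real \<Rightarrow> real \<Rightarrow> real \<Rightarrow> (real \<Rightarrow> real) \<Rightarrow> ('a::metric_space \<Rightarrow> 'a) \<Rightarrow> 'a \<Rightarrow> bool" where
  "pata_zamfirescu_mapping \<Lambda> \<alpha> \<beta> \<Psi> T x0 \<longleftrightarrow>
     (\<forall>u. \<forall>\<epsilon>\<in>{0..1}. dist (T u) u > 0 \<longrightarrow>
        dist (T u) u \<le> (1 - \<epsilon>) / 2 * zamf_max T u x0
          + \<Lambda> * \<epsilon> powr \<alpha> * \<Psi> \<epsilon> *
            (1 + dist u x0 + dist x0 x0 + dist (T u) x0 + dist (T x0) x0) powr \<beta>)"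

text \<open>
  The infimum ranges over the empty set exactly when \<open>T\<close> is the identity.  Then its value is
  unspecified, but every disc is fixed, so the convention for the empty infimum is immaterial.
\<close>

definition displacement_inf :: "('a::metric_space \<Rightarrow> 'a) \<Rightarrow> real" where
  "displacement_inf T = Inf {dist (T u) u |u. T u \<noteq> u}"

definition fixed_disc :: "('a::metric_space \<Rightarrow> 'a) \<Rightarrow> 'a \<Rightarrow> real \<Rightarrow> bool" where
  "fixed_disc T x0 r \<longleftrightarrow> (\<forall>u\<in>cball x0 r. T u = u)"

end

theory Submission
  imports Defs
begin

text \<open>
  Only \<open>\<epsilon> = 0\<close> is needed: there the contractive condition reads \<open>d(Tu,u) \<le> M(u,x0) / 2\<close>.  At \<open>u = x0\<close>
  it forces \<open>T x0 = x0\<close>.  At a moved point \<open>u\<close> of the disc, \<open>M(u,x0)\<close> is then at most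
  \<open>max r (d(Tu,u) / 2)\<close>, whereas \<open>0 < d(Tu,u)\<close> and \<open>r \<le> d(Tu,u)\<close>.
\<close>

lemma pata_zamfirescu_mapping_half:
  assumes "pata_zamfirescu_mapping \<Lambda> \<alpha> \<beta> \<Psi> T x0" and "T u \<noteq> u"
  shows "dist (T u) u \<le> zamf_max T u x0 / 2"
proof -
  have "dist (T u) u \<le> (1 - 0) / 2 * zamf_max T u x0
          + \<Lambda> * 0 powr \<alpha> * \<Psi> 0 *
            (1 + dist u x0 + dist x0 x0 + dist (T u) x0 + dist (T x0) x0) powr \<beta>"
    using assms unfolding pata_zamfirescu_mapping_def
    by (metis atLeastAtMost_iff order_refl zero_le_one zero_less_dist_iff)
  \<comment> \<open>\<open>0 powr \<alpha>\<close> is 0, so the perturbation term vanishes whatever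
    the bracket.\<close>
  then show ?thesis by simp
qed

lemma pata_zamfirescu_mapping_fixes_center:
  assumes "pata_zamfirescu_mapping \<Lambda> \<alpha> \<beta> \<Psi> T x0"
  shows "T x0 = x0"
proof (rule ccontr)
  assume moved: "T x0 \<noteq> x0"
  \<comment> \<open>The three entries of the maximum are 0 and twice
    \<open>dist (T x0) x0\<close>.\<close>
  have "zamf_max T x0 x0 = dist (T x0) x0"
    by (simp add: zamf_max_def)
  then have "dist (T x0) x0 \<le> dist (T x0) x0 / 2"
    using pata_zamfirescu_mapping_half[OF assms moved] by simp
  with moved show False by simp
qed

text \<open>Displacements are bounded below by 0, so the real infimum is a true lower bound.\<close>

lemma displacement_inf_le:
  assumes "T u \<noteq> u"
  shows "displacement_inf T \<le> dist (T u) u"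
  unfolding displacement_inf_def
  by (rule cInf_lower) (use assms in \<open>auto intro: bdd_belowI[of _ 0]\<close>)

theorem theorem2p9:
  fixes T :: "'a::metric_space \<Rightarrow> 'a" and x0 :: 'a
    and \<Lambda> \<alpha> \<beta> r :: real and \<Psi> :: "real \<Rightarrow> real"
  assumes "\<Lambda> \<ge> 0" and "\<alpha> \<ge> 1" and "\<beta> \<in> {0..\<alpha>}"
    and "\<Psi> \<in> Theta_class"
    and "r = displacement_inf T"
    and "pata_zamfirescu_mapping \<Lambda> \<alpha> \<beta> \<Psi> T x0"
    and "\<forall>u \<in> cball x0 r - {x0}. dist (T u) x0 \<le> r"
  shows "fixed_disc T x0 r"
  unfolding fixed_disc_def
proof (intro ballI, rule ccontr)
  fix u assume u: "u \<in> cball x0 r" and moved: "T u \<noteq> u"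
  note center = pata_zamfirescu_mapping_fixes_center[OF assms(6)]
  from moved center have "u \<noteq> x0" by auto
  with assms(7) u have Tu: "dist (T u) x0 \<le> r" by simp
  from u have ux0: "dist u x0 \<le> r" by (simp add: dist_commute)
  \<comment> \<open>As \<open>x0\<close> is fixed, the middle entry is
    \<open>dist (T u) u / 2\<close>; the last averages \<open>dist x0 u\<close> and
    \<open>dist (T u) x0\<close>, both at most \<open>r\<close>.\<close>
  have "zamf_max T u x0 \<le> max r (dist (T u) u / 2)"
    using Tu ux0 by (auto simp: zamf_max_def center dist_commute max_def)
  moreover have "r \<le> dist (T u) u"
    using displacement_inf_le[of T u] moved assms(5) by simp
  ultimately have "zamf_max T u x0 \<le> dist (T u) u"
    using zero_le_dist[of "T u" u] by linarith
  with pata_zamfirescu_mapping_half[OF assms(6) moved]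
  have "dist (T u) u \<le> dist (T u) u / 2" by linarith
  with moved show False by simp
qed

end
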